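(* Let $k,n$ be positive integers. If $n \ge 5k-\sqrt{4k-2}-3$ and $n \ge 5k-0.5k-4$, then for any 2-edge-coloring (red/blue) of the complete graph $K_n$, there exists a $k$-connected monochromatic subgraph containing at least $n-2k+2$ vertices.
   Context: A graph is $k$-connected if it has more than $k$ vertices and has no vertex cut of size at most $k-1$. A monochromatic subgraph is a subgraph all of whose edges have the same color.
   Formalization: The case k = n = 1 is excluded: both bounds on n hold there, but K_1 has only one vertex while a 1-connected graph must have more than one, so the claim fails. *)

theory Defs
  imports Complex_Main "Graph_Theory.Graph_Theory"
begin

text \<open>Undirected graphs are symmetric digraphs (locale \<^locale>\<open>graph\<close>): every edge \<open>{u, v}\<close> is
  represented by the two arcs \<open>(u, v)\<close> and \<open>(v, u)\<close>.\<close>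

datatype colour = Red | Blue

text \<open>A colouring is a function on unordered pairs, so that the two arcs of an edge have the same
  colour; its values on sets that are not edges are irrelevant.\<close>

definition monochromatic :: "('a set \<Rightarrow> colour) \<Rightarrow> ('a, 'b) pre_digraph \<Rightarrow> bool" where
  "monochromatic c H \<longleftrightarrow> (\<exists>col. \<forall>e \<in> arcs H. c {tail H e, head H e} = col)"

text \<open>The name \<open>connected\<close> is qualified because of the topological notion of the same name. The null
  graph is not \<open>Digraph_Component.connected\<close>, so \<open>S = verts G\<close> has to be excluded explicitly.\<close>

definition vertex_cut :: "('a, 'b) pre_digraph \<Rightarrow> 'a set \<Rightarrow> bool" where
  "vertex_cut G S \<longleftrightarrow>
     S \<subset> verts G \<and> \<not> Digraph_Component.connected (G \<restriction> (verts G - S))"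

text \<open>The bound \<open>card S < k\<close> stands for \<open>card S \<le> k - 1\<close>, avoiding truncated subtraction.\<close>

definition k_connected :: "nat \<Rightarrow> ('a, 'b) pre_digraph \<Rightarrow> bool" where
  "k_connected k G \<longleftrightarrow>
     graph G \<and> k < card (verts G) \<and> \<not> (\<exists>S. vertex_cut G S \<and> card S < k)"

end

theory Submission
  imports Defs
begin

text \<open>Put \<open>m = k - 1\<close> and suppose that no monochromatic subgraph is as required. Then the red graph
  on any \<open>n - 2 m\<close> or more vertices has a cut of size at most \<open>m\<close>. One side of the cut has at most
  \<open>m\<close> vertices, for otherwise the blue edges between the two sides give a \<open>k\<close>-connected graph.
  Removing the small side and repeating, one peels off a set \<open>A\<close> with \<open>2 m < card A \<le> 3 m\<close>,
  each vertex of which has at most \<open>m\<close> red neighbours outside its own step among the vertices then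
  remaining. The blue graph likewise yields a set \<open>D\<close>. If \<open>A\<close> and \<open>D\<close> are disjoint, counting the
  pairs between them gives \<open>card A * card D \<le> m * (card A + card D)\<close>, which is absurd. In general
  each vertex of \<open>A \<inter> D\<close> spoils fewer than \<open>m\<close> pairs, while its pairs with all other vertices also
  enter the count; the bounds on \<open>n\<close> are what makes the resulting quadratic inequality fail.\<close>

section \<open>Separations, and vertex sets that have none\<close>

text \<open>With \<open>m = k - 1\<close> and a symmetric \<open>E\<close>, the negation is the cut
  condition of \<open>k\<close>-connectedness for the graph of \<open>E\<close> on \<open>W\<close>.
  Using relations lets the two colours exchange roles and keeps digraphs out of the combinatorial
  part.\<close>

definition separated :: "('a \<Rightarrow> 'a \<Rightarrow> bool) \<Rightarrow> nat \<Rightarrow> 'a set \<Rightarrow> bool" where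
  "separated E m W \<longleftrightarrow>
     (\<exists>P S Q. W = P \<union> S \<union> Q \<and> P \<inter> S = {} \<and> P \<inter> Q = {} \<and> S \<inter> Q = {} \<and>
        P \<noteq> {} \<and> Q \<noteq> {} \<and> card S \<le> m \<and> (\<forall>x\<in>P. \<forall>y\<in>Q. \<not> E x y))"

text \<open>A set \<open>S\<close> of at most \<open>m\<close> vertices spares some \<open>p\<close>
  in \<open>P\<close> and some \<open>q\<close> in \<open>Q\<close>. These two hold together what
  remains of \<open>P\<close> and \<open>Q\<close>, and every vertex of \<open>A\<close> keeps a
  neighbour there.\<close>

lemma not_separated_bipartite:
  assumes fin: "finite P" "finite Q"
    and disj: "P \<inter> Q = {}" "(P \<union> Q) \<inter> A = {}"
    and symF: "\<And>x y. F x y \<Longrightarrow> F y x"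
    and PQ: "\<And>x y. x \<in> P \<Longrightarrow> y \<in> Q \<Longrightarrow> F x y"
    and large: "m < card P" "m < card Q"
    and A: "\<And>x. x \<in> A \<Longrightarrow> m < card {y \<in> P \<union> Q. F x y}"
    and "finite A"
  shows "\<not> separated F m (P \<union> Q \<union> A)"
proof
  assume "separated F m (P \<union> Q \<union> A)"
  then obtain X S Y where W: "P \<union> Q \<union> A = X \<union> S \<union> Y"
    and XSY: "X \<inter> S = {}" "X \<inter> Y = {}" "S \<inter> Y = {}" "X \<noteq> {}" "Y \<noteq> {}"
    and S: "card S \<le> m" and XY: "\<And>x y. x \<in> X \<Longrightarrow> y \<in> Y \<Longrightarrow> \<not> F x y"
    unfolding separated_def by metis
  have finS: "finite S"
    using W fin \<open>finite A\<close> by (metis finite_Un)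
  have avoid: "\<exists>z\<in>Z. z \<notin> S" if "m < card Z" for Z
  proof (rule ccontr)
    assume "\<not> ?thesis"
    then have "Z \<subseteq> S" by auto
    then have "card Z \<le> card S" by (rule card_mono[OF finS])
    then show False using that S by linarith
  qed
  obtain p q where p: "p \<in> P" "p \<notin> S" and q: "q \<in> Q" "q \<notin> S"
    using avoid large by meson
  \<comment> \<open>\<open>X'\<close> stands for whichever side contains \<open>p\<close>. Then
    \<open>Y'\<close> misses \<open>Q\<close>, so \<open>q\<close> is in \<open>X'\<close> and
    \<open>Y'\<close> misses \<open>P\<close> too; a vertex of \<open>A\<close> in \<open>Y'\<close>
    would have a neighbour in \<open>X'\<close>.\<close>
  have one_side: False
    if cover: "P \<union> Q \<union> A = X' \<union> S \<union> Y'" and d: "X' \<inter> Y' = {}" "S \<inter> Y' = {}" and ne: "Y' \<noteq> {}"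
      and pX: "p \<in> X'" and no: "\<And>x y. x \<in> X' \<Longrightarrow> y \<in> Y' \<Longrightarrow> \<not> F x y" for X' Y'
  proof -
    have Q: "Q \<inter> Y' = {}" using PQ[OF p(1)] no[OF pX] by auto
    then have "q \<in> X'" using q cover by auto
    then have P: "P \<inter> Y' = {}" using PQ[OF _ q(1)] no symF by blast
    obtain y where y: "y \<in> Y'" using ne by auto
    then have "y \<in> A" using P Q cover by auto
    then obtain z where "z \<in> P \<union> Q" "F y z" "z \<notin> S" using avoid[OF A] by auto
    moreover then have "z \<in> X'" using P Q cover by auto
    ultimately show False using no y symF by blast
  qed
  have YX: "\<not> F y x" if "y \<in> Y" "x \<in> X" for x y
    using XY[OF that(2,1)] symF by blast
  have "p \<in> X \<or> p \<in> Y" using p W by auto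
  then show False
  proof
    assume "p \<in> X"
    then show False using one_side[of X Y] W XSY XY by blast
  next
    assume "p \<in> Y"
    moreover have "P \<union> Q \<union> A = Y \<union> S \<union> X" using W by auto
    ultimately show False using one_side[of Y X] XSY YX by blast
  qed
qed

section \<open>Peeling off the small sides of cuts\<close>

text \<open>The function \<open>lev\<close> records in which of \<open>N\<close> steps a vertex is removed, with \<open>lev x = N\<close> if it
  survives; at step \<open>i\<close> the cut \<open>S i\<close> separates the removed vertices from all other remaining ones.\<close>

definition peeling ::
  "'a set \<Rightarrow> ('a \<Rightarrow> 'a \<Rightarrow> bool) \<Rightarrow> nat \<Rightarrow> nat \<Rightarrow> ('a \<Rightarrow> nat) \<Rightarrow> (nat \<Rightarrow> 'a set) \<Rightarrow> bool" where
  "peeling V E m N lev S \<longleftrightarrow>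
     (\<forall>x\<in>V. lev x \<le> N) \<and>
     (\<forall>i<N. card {x\<in>V. lev x = i} \<le> m \<and> card (S i) \<le> m \<and> S i \<subseteq> V) \<and>
     (\<forall>x\<in>V. \<forall>y\<in>V. lev x < N \<longrightarrow> lev x < lev y \<longrightarrow> E x y \<longrightarrow> y \<in> S (lev x))"

lemma peelingD:
  assumes "peeling V E m N lev S"
  shows "x \<in> V \<Longrightarrow> lev x \<le> N"
    and "i < N \<Longrightarrow> card {x\<in>V. lev x = i} \<le> m"
    and "i < N \<Longrightarrow> card (S i) \<le> m"
    and "i < N \<Longrightarrow> S i \<subseteq> V"
    and "x \<in> V \<Longrightarrow> y \<in> V \<Longrightarrow> lev x < N \<Longrightarrow> lev x < lev y \<Longrightarrow> E x y \<Longrightarrow> y \<in> S (lev x)"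
  using assms unfolding peeling_def by blast+

text \<open>The smaller side \<open>P\<close> of an \<open>E\<close>-cut of the survivors becomes
  the next level. Were it larger than \<open>m\<close>, then \<open>F\<close> would contain all
  pairs between the two sides, and each vertex removed earlier would keep more than \<open>m\<close>
  neighbours in \<open>F\<close> there. The two sides and the removed vertices would then form a set
  not separated in \<open>F\<close> that misses only the cut.\<close>

lemma peeling_extend:
  assumes fin: "finite V" and p: "peeling V E m N lev S"
    and E_sym: "\<And>x y. E x y \<Longrightarrow> E y x" and F_sym: "\<And>x y. F x y \<Longrightarrow> F y x"
    and EF: "\<And>x y. x \<in> V \<Longrightarrow> y \<in> V \<Longrightarrow> x \<noteq> y \<Longrightarrow> E x y \<or> F x y"
    and sep_E: "\<And>W. W \<subseteq> V \<Longrightarrow> card V \<le> card W + 2 * m \<Longrightarrow> separated E m W"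
    and sep_F: "\<And>W. W \<subseteq> V \<Longrightarrow> card V \<le> card W + 2 * m \<Longrightarrow> separated F m W"
    and small: "card {x\<in>V. lev x < N} \<le> 2 * m"
  obtains lev' S' where "peeling V E m (Suc N) lev' S'"
    "card {x\<in>V. lev x < N} < card {x\<in>V. lev' x < Suc N}"
    "card {x\<in>V. lev' x < Suc N} \<le> card {x\<in>V. lev x < N} + m"
proof -
  define A where "A = {x\<in>V. lev x < N}"
  have AV: "A \<subseteq> V" "finite A" using fin by (auto simp: A_def)
  have cV: "card V = card (V - A) + card A"
    using AV fin by (simp add: card_Diff_subset card_mono)
  then have "separated E m (V - A)"
    using small by (intro sep_E) (auto simp: A_def)
  then obtain X Z Y where XZY: "V - A = X \<union> Z \<union> Y" "X \<inter> Z = {}" "X \<inter> Y = {}" "Z \<inter> Y = {}"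
      "X \<noteq> {}" "Y \<noteq> {}" "card Z \<le> m" "\<And>x y. x \<in> X \<Longrightarrow> y \<in> Y \<Longrightarrow> \<not> E x y"
    unfolding separated_def by metis
  have "\<exists>P Q. V - A = P \<union> Z \<union> Q \<and> P \<inter> Z = {} \<and> P \<inter> Q = {} \<and> Z \<inter> Q = {} \<and> P \<noteq> {} \<and>
      (\<forall>x\<in>P. \<forall>y\<in>Q. \<not> E x y) \<and> card P \<le> card Q"
  proof (cases "card X \<le> card Y")
    case True
    then show ?thesis using XZY by (intro exI[of _ X] exI[of _ Y]) auto
  next
    case False
    have "\<forall>x\<in>Y. \<forall>y\<in>X. \<not> E x y" using XZY(8) E_sym by blast
    moreover have "V - A = Y \<union> Z \<union> X" using XZY(1) by auto
    ultimately show ?thesis using XZY(2-6) False by (intro exI[of _ Y] exI[of _ X]) auto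
  qed
  then obtain P Q where PQ: "V - A = P \<union> Z \<union> Q" "P \<inter> Z = {}" "P \<inter> Q = {}" "Z \<inter> Q = {}" "P \<noteq> {}"
      "\<And>x y. x \<in> P \<Longrightarrow> y \<in> Q \<Longrightarrow> \<not> E x y" "card P \<le> card Q" by metis
  have fins: "finite P" "finite Q" "finite Z"
    using PQ(1) fin by (metis finite_Diff finite_Un)+
  have subs: "P \<subseteq> V" "Q \<subseteq> V" "Z \<subseteq> V" "P \<inter> A = {}" "Q \<inter> A = {}" "Z \<inter> A = {}"
    using PQ(1) by auto
  have "card P \<le> m"
  proof (rule ccontr)
    assume "\<not> card P \<le> m"
    then have large: "m < card P" "m < card Q" using PQ by auto
    have "\<not> separated F m (P \<union> Q \<union> A)"
    proof (rule not_separated_bipartite)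
      show "F x y" if "x \<in> P" "y \<in> Q" for x y
        using EF[of x y] PQ that subs by blast
      show "m < card {y \<in> P \<union> Q. F x y}" if "x \<in> A" for x
      proof -
        have lx: "lev x < N" "x \<in> V" using that by (auto simp: A_def)
        \<comment> \<open>A pair outside \<open>F\<close> is in \<open>E\<close>, hence leads into
          the cut \<open>S (lev x)\<close>. This costs at most \<open>m\<close> of the at least
          \<open>2 * m + 2\<close> vertices on the two sides.\<close>
        have "P \<union> Q \<subseteq> {y \<in> P \<union> Q. F x y} \<union> S (lev x)"
        proof
          fix y assume y: "y \<in> P \<union> Q"
          then have yV: "y \<in> V" "y \<notin> A" "x \<noteq> y" using subs that by auto
          then have "lev x < lev y" using lx by (auto simp: A_def)
          then show "y \<in> {y \<in> P \<union> Q. F x y} \<union> S (lev x)"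
            using EF[of x y] peelingD(5)[OF p, of x y] lx yV y by auto
        qed
        then have "card (P \<union> Q) \<le> card ({y \<in> P \<union> Q. F x y} \<union> S (lev x))"
          using fins peelingD(4)[OF p lx(1)] fin by (intro card_mono) (auto intro: finite_subset)
        also have "\<dots> \<le> card {y \<in> P \<union> Q. F x y} + card (S (lev x))"
          by (rule card_Un_le)
        also have "\<dots> \<le> card {y \<in> P \<union> Q. F x y} + m"
          using peelingD(3)[OF p lx(1)] by simp
        finally show ?thesis using large fins PQ(3) by (simp add: card_Un_disjoint)
      qed
      show "F y x" if "F x y" for x y by (rule F_sym[OF that])
    qed (use fins subs PQ(3) large AV in auto)
    moreover have "separated F m (P \<union> Q \<union> A)"
    proof (rule sep_F)
      have "V = (P \<union> Q \<union> A) \<union> Z" using PQ(1) AV by auto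
      then have "card V \<le> card (P \<union> Q \<union> A) + card Z" by (metis card_Un_le)
      then show "card V \<le> card (P \<union> Q \<union> A) + 2 * m" using XZY(7) by simp
    qed (use subs AV in auto)
    ultimately show False by simp
  qed
  \<comment> \<open>The vertices of \<open>P\<close> keep the value \<open>N\<close>, which no
    longer marks survivors; the other survivors move up to \<open>Suc N\<close>.\<close>
  define lev' where "lev' x = (if lev x < N then lev x else if x \<in> P then N else Suc N)" for x
  define S' where "S' = S(N := Z)"
  have A': "{x\<in>V. lev' x < Suc N} = A \<union> P"
    using subs by (auto simp: lev'_def A_def)
  have lev_eq: "{x\<in>V. lev' x = i} = {x\<in>V. lev x = i}" if "i < N" for i
    using that by (auto simp: lev'_def)
  have lev_N: "{x\<in>V. lev' x = N} = P"
    using subs by (auto simp: lev'_def A_def)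
  have "peeling V E m (Suc N) lev' S'"
    unfolding peeling_def
  proof (intro conjI allI impI ballI)
    fix x assume "x \<in> V" then show "lev' x \<le> Suc N" by (simp add: lev'_def)
  next
    fix i assume i: "i < Suc N"
    show "card {x\<in>V. lev' x = i} \<le> m"
      using i lev_eq peelingD(2)[OF p, of i] lev_N \<open>card P \<le> m\<close> by (cases "i < N") (auto simp: less_Suc_eq)
    show "card (S' i) \<le> m" "S' i \<subseteq> V"
      using i peelingD(3,4)[OF p, of i] XZY(7) subs by (auto simp: S'_def less_Suc_eq)
  next
    fix x y assume xy: "x \<in> V" "y \<in> V" "lev' x < Suc N" "lev' x < lev' y" "E x y"
    show "y \<in> S' (lev' x)"
    proof (cases "lev x < N")
      case True
      then have "lev x < lev y"
        using xy by (auto simp: lev'_def split: if_splits)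
      then show ?thesis
        using True peelingD(5)[OF p, of x y] xy by (simp add: lev'_def S'_def)
    next
      case False
      then have "x \<in> P" "lev' x = N" using xy by (auto simp: lev'_def split: if_splits)
      moreover from this have "y \<notin> P" "y \<notin> A"
        using xy by (auto simp: lev'_def A_def split: if_splits)
      ultimately show ?thesis using PQ xy by (auto simp: S'_def)
    qed
  qed
  moreover have "card (A \<union> P) = card A + card P"
    using AV fins subs by (intro card_Un_disjoint) auto
  moreover have "0 < card P" using fins PQ by (simp add: card_gt_0_iff)
  ultimately show thesis
    using that[of lev' S'] \<open>card P \<le> m\<close> A' by (simp add: A_def)
qed

text \<open>A step removes at least one and at most \<open>m\<close> vertices and is possible while
  at most \<open>2 * m\<close> are gone, so the first total above \<open>2 * m\<close> is at most
  \<open>3 * m\<close>.\<close>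

lemma ex_peeling:
  assumes fin: "finite V"
    and E_sym: "\<And>x y. E x y \<Longrightarrow> E y x" and F_sym: "\<And>x y. F x y \<Longrightarrow> F y x"
    and EF: "\<And>x y. x \<in> V \<Longrightarrow> y \<in> V \<Longrightarrow> x \<noteq> y \<Longrightarrow> E x y \<or> F x y"
    and sep_E: "\<And>W. W \<subseteq> V \<Longrightarrow> card V \<le> card W + 2 * m \<Longrightarrow> separated E m W"
    and sep_F: "\<And>W. W \<subseteq> V \<Longrightarrow> card V \<le> card W + 2 * m \<Longrightarrow> separated F m W"
  obtains N lev S where "peeling V E m N lev S"
    "2 * m < card {x\<in>V. lev x < N}" "card {x\<in>V. lev x < N} \<le> 3 * m"
proof -
  \<comment> \<open>The induction runs over a lower bound \<open>t\<close> for the number of removed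
    vertices: a step may overshoot \<open>t\<close>, and then nothing is to be done until
    \<open>t\<close> catches up.\<close>
  have "\<exists>N lev S. peeling V E m N lev S \<and> t \<le> card {x\<in>V. lev x < N} \<and> card {x\<in>V. lev x < N} \<le> 3 * m"
    if "t \<le> Suc (2 * m)" for t
    using that
  proof (induction t)
    case 0
    have "peeling V E m 0 (\<lambda>_. 0) (\<lambda>_. {})" by (simp add: peeling_def)
    then show ?case by (intro exI conjI) auto
  next
    case (Suc t)
    then obtain N lev S where p: "peeling V E m N lev S" "t \<le> card {x\<in>V. lev x < N}"
        "card {x\<in>V. lev x < N} \<le> 3 * m" by auto
    show ?case
    proof (cases "Suc t \<le> card {x\<in>V. lev x < N}")
      case True
      then show ?thesis using p by blast
    next
      case False
      then have t: "card {x\<in>V. lev x < N} = t" "t \<le> 2 * m" using p Suc.prems by auto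
      obtain lev' S' where p': "peeling V E m (Suc N) lev' S'"
          "card {x\<in>V. lev x < N} < card {x\<in>V. lev' x < Suc N}"
          "card {x\<in>V. lev' x < Suc N} \<le> card {x\<in>V. lev x < N} + m"
        using E_sym F_sym EF sep_E sep_F t(2)[folded t(1)]
        by (rule peeling_extend[OF fin p(1), where F = F])
      then have "Suc t \<le> card {x\<in>V. lev' x < Suc N}" "card {x\<in>V. lev' x < Suc N} \<le> 3 * m"
        using t by linarith+
      then show ?thesis using p'(1) by blast
    qed
  qed
  from this[of "Suc (2 * m)"] show thesis using that by (auto simp: Suc_le_eq)
qed

section \<open>Counting the pairs accounted for by two peelings\<close>

lemma card_Sigma_le:
  assumes "finite A" "\<And>x. x \<in> A \<Longrightarrow> finite (B x)" "\<And>x. x \<in> A \<Longrightarrow> card (B x) \<le> m"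
  shows "card (Sigma A B) \<le> m * card A"
  using assms sum_bounded_above[of A "\<lambda>x. card (B x)" m] by (simp add: mult.commute)

text \<open>Double counting of ordered pairs. A pair is accounted for by a peeling if one of its members is
  removed and the other lies in the corresponding cut. Every pair between \<open>A - D\<close> and \<open>D - A\<close> is
  accounted for. For \<open>x \<in> A \<inter> D\<close> the exceptions are the vertices in \<open>bad x\<close>, and bad pairs seen from
  the other side, and the vertices on the same two levels. The two sets making up \<open>bad x\<close> cannot
  both be nonempty: a pair taken from them would have neither colour.\<close>

lemma peelings_count:
  assumes fin: "finite V"
    and pE: "peeling V E m N lev S" and pF: "peeling V F m N' lev' T"
    and E_sym: "\<And>x y. E x y \<Longrightarrow> E y x" and F_sym: "\<And>x y. F x y \<Longrightarrow> F y x"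
    and EF: "\<And>x y. x \<in> V \<Longrightarrow> y \<in> V \<Longrightarrow> x \<noteq> y \<Longrightarrow> E x y \<or> F x y"
  defines "A \<equiv> {x\<in>V. lev x < N}" and "D \<equiv> {x\<in>V. lev' x < N'}"
  shows "2 * card (A - D) * card (D - A) + card (A \<inter> D) ^ 2
           + 2 * card (A \<inter> D) * (card V - card (A \<inter> D)) + card (A \<inter> D)
         \<le> 2 * m * (card A + card D) + 2 * m * card (A \<inter> D)"
proof -
  define I where "I = A \<inter> D"
  define bad where "bad x = {y\<in>V. lev' y = lev' x \<and> lev x < lev y \<and> y \<notin> S (lev x)} \<union>
      {y\<in>V. lev y = lev x \<and> lev' x < lev' y \<and> y \<notin> T (lev' x)}" for x
  define cell where "cell x = {y\<in>V. lev y = lev x \<and> lev' y = lev' x}" for x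
  define C where "C = (SIGMA x:A. S (lev x))"
  define C' where "C' = (SIGMA x:D. T (lev' x))"
  define B where "B = (SIGMA x:I. bad x)"
  define L where "L = (SIGMA x:I. cell x)"
  have subs: "A \<subseteq> V" "D \<subseteq> V" "I \<subseteq> V" by (auto simp: A_def D_def I_def)
  then have fins: "finite A" "finite D" "finite I" using fin by (auto intro: finite_subset)
  have fin_bad: "finite (bad x)" and fin_cell: "finite (cell x)" for x
    using fin by (auto simp: bad_def cell_def)
  have bad_cell: "card (bad x) + card (cell x) \<le> m" and cell_pos: "0 < card (cell x)" if x: "x \<in> I" for x
  proof -
    have xl: "x \<in> V" "lev x < N" "lev' x < N'" using x by (auto simp: I_def A_def D_def)
    have "x \<in> cell x" using xl by (simp add: cell_def)
    then show "0 < card (cell x)" using fin_cell card_gt_0_iff by blast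
    have nb: "\<not> (y \<in> V \<and> lev' y = lev' x \<and> lev x < lev y \<and> y \<notin> S (lev x) \<and>
        z \<in> V \<and> lev z = lev x \<and> lev' x < lev' z \<and> z \<notin> T (lev' x))" for y z
    proof
      assume *: "y \<in> V \<and> lev' y = lev' x \<and> lev x < lev y \<and> y \<notin> S (lev x) \<and>
        z \<in> V \<and> lev z = lev x \<and> lev' x < lev' z \<and> z \<notin> T (lev' x)"
      then have "\<not> E z y" using peelingD(5)[OF pE, of z y] xl by auto
      moreover have "\<not> F y z" using peelingD(5)[OF pF, of y z] xl * by auto
      moreover have "z \<noteq> y" using * by auto
      ultimately show False using EF[of z y] F_sym[of z y] * by blast
    qed
    \<comment> \<open>As one of the two sets making up \<open>bad x\<close> is empty, everything
      lies in a single level of one of the peelings.\<close>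
    have "bad x \<union> cell x \<subseteq> {y\<in>V. lev y = lev x} \<or> bad x \<union> cell x \<subseteq> {y\<in>V. lev' y = lev' x}"
    proof (cases "\<exists>y\<in>V. lev' y = lev' x \<and> lev x < lev y \<and> y \<notin> S (lev x)")
      case True
      then show ?thesis using nb by (auto simp: bad_def cell_def)
    next
      case False
      then show ?thesis by (auto simp: bad_def cell_def)
    qed
    then have "card (bad x \<union> cell x) \<le> m"
    proof
      assume "bad x \<union> cell x \<subseteq> {y\<in>V. lev y = lev x}"
      then have "card (bad x \<union> cell x) \<le> card {y\<in>V. lev y = lev x}"
        using fin by (intro card_mono) auto
      then show ?thesis using peelingD(2)[OF pE xl(2)] by simp
    next
      assume "bad x \<union> cell x \<subseteq> {y\<in>V. lev' y = lev' x}"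
      then have "card (bad x \<union> cell x) \<le> card {y\<in>V. lev' y = lev' x}"
        using fin by (intro card_mono) auto
      then show ?thesis using peelingD(2)[OF pF xl(3)] by simp
    qed
    moreover have "card (bad x \<union> cell x) = card (bad x) + card (cell x)"
      using fin_bad fin_cell by (intro card_Un_disjoint) (auto simp: bad_def cell_def)
    ultimately show "card (bad x) + card (cell x) \<le> m" by simp
  qed
  have ST: "card (S (lev x)) \<le> m" "finite (S (lev x))" if "x \<in> A" for x
    using that peelingD(3,4)[OF pE, of "lev x"] fin by (auto simp: A_def intro: finite_subset)
  have TT: "card (T (lev' x)) \<le> m" "finite (T (lev' x))" if "x \<in> D" for x
    using that peelingD(3,4)[OF pF, of "lev' x"] fin by (auto simp: D_def intro: finite_subset)
  have card_C: "card C \<le> m * card A"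
    unfolding C_def by (rule card_Sigma_le) (use fins ST in auto)
  have card_C': "card C' \<le> m * card D"
    unfolding C'_def by (rule card_Sigma_le) (use fins TT in auto)
  have finC: "finite C" "finite C'" "finite B" "finite L"
    unfolding C_def C'_def B_def L_def using fins ST TT fin_bad fin_cell by auto
  \<comment> \<open>\<open>B\<close> will be counted in both orders, but \<open>L\<close> only once,
    being symmetric. Since \<open>cell x\<close> contains \<open>x\<close>, replacing one of two
    copies of \<open>card (cell x)\<close> by \<open>1\<close> loses nothing; this is the source of
    the summand \<open>card I\<close>.\<close>
  have "2 * card B + card L = (\<Sum>x\<in>I. 2 * card (bad x) + card (cell x))"
    unfolding B_def L_def using fins fin_bad fin_cell by (simp add: sum.distrib sum_distrib_left)
  also have "\<dots> + card I = (\<Sum>x\<in>I. 2 * card (bad x) + card (cell x) + 1)"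
    using fins by (simp only: sum.distrib card_eq_sum)
  also have "\<dots> \<le> (\<Sum>x\<in>I. 2 * m)"
  proof (rule sum_mono)
    fix x assume "x \<in> I"
    then show "2 * card (bad x) + card (cell x) + 1 \<le> 2 * m"
      using bad_cell[of x] cell_pos[of x] by linarith
  qed
  finally have card_BL: "2 * card B + card L + card I \<le> 2 * m * card I" by (simp add: mult.commute)

  define Cov where "Cov = C \<union> C\<inverse> \<union> C' \<union> C'\<inverse> \<union> B \<union> B\<inverse> \<union> L"
  have E_cov: "(x, y) \<in> C \<union> C\<inverse>" if "x \<in> V" "y \<in> V" "E x y" "lev x \<noteq> lev y" for x y
    using that peelingD(5)[OF pE, of x y] peelingD(5)[OF pE, of y x]
      peelingD(1)[OF pE, of x] peelingD(1)[OF pE, of y] E_sym[of x y]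
    by (cases "lev x < lev y") (auto simp: C_def A_def)
  have F_cov: "(x, y) \<in> C' \<union> C'\<inverse>" if "x \<in> V" "y \<in> V" "F x y" "lev' x \<noteq> lev' y" for x y
    using that peelingD(5)[OF pF, of x y] peelingD(5)[OF pF, of y x]
      peelingD(1)[OF pF, of x] peelingD(1)[OF pF, of y] F_sym[of x y]
    by (cases "lev' x < lev' y") (auto simp: C'_def D_def)
  have I_cov: "(x, y) \<in> Cov \<and> (y, x) \<in> Cov" if x: "x \<in> I" and y: "y \<in> V" for x y
  proof -
    have xl: "x \<in> V" "lev x < N" "lev' x < N'" using x by (auto simp: I_def A_def D_def)
    have L: ?thesis if "lev x = lev y" "lev' x = lev' y"
      using that x y xl by (auto simp: Cov_def L_def cell_def I_def A_def D_def)
    have E: ?thesis if "E x y"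
    proof (cases "lev x = lev y")
      case False
      then show ?thesis using E_cov[of x y] that xl y by (auto simp: Cov_def)
    next
      \<comment> \<open>Within one level of \<open>lev\<close> the first peeling says nothing about
        the pair. If the levels \<open>lev'\<close> differ, the member that the second peeling
        removes first has the other in its cut or in its \<open>bad\<close> set.\<close>
      case True
      consider "lev' x = lev' y" | "lev' x < lev' y" | "lev' y < lev' x" by linarith
      then show ?thesis
      proof cases
        case 1 then show ?thesis using L True by simp
      next
        case 2
        then have "(x, y) \<in> C' \<union> B"
          using x y True by (auto simp: C'_def B_def bad_def I_def)
        then show ?thesis by (auto simp: Cov_def)
      next
        case 3
        \<comment> \<open>\<open>y\<close> shares its \<open>lev\<close> with \<open>x\<close> and
          has a smaller \<open>lev'\<close>, so both peelings remove it.\<close>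
        then have "y \<in> I" using True xl y by (auto simp: I_def A_def D_def)
        then have "(y, x) \<in> C' \<union> B"
          using 3 xl True by (auto simp: C'_def B_def bad_def I_def)
        then show ?thesis by (auto simp: Cov_def)
      qed
    qed
    have F: ?thesis if "F x y"
    proof (cases "lev' x = lev' y")
      case False
      then show ?thesis using F_cov[of x y] that xl y by (auto simp: Cov_def)
    next
      case True
      consider "lev x = lev y" | "lev x < lev y" | "lev y < lev x" by linarith
      then show ?thesis
      proof cases
        case 1 then show ?thesis using L True by simp
      next
        case 2
        then have "(x, y) \<in> C \<union> B"
          using x y True by (auto simp: C_def B_def bad_def I_def)
        then show ?thesis by (auto simp: Cov_def)
      next
        case 3
        then have "y \<in> I" using True xl y by (auto simp: I_def A_def D_def)
        then have "(y, x) \<in> C \<union> B"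
          using 3 xl True by (auto simp: C_def B_def bad_def I_def)
        then show ?thesis by (auto simp: Cov_def)
      qed
    qed
    show ?thesis
      using E F L EF[of x y] xl y by (cases "x = y") auto
  qed
  have AD_cov: "(x, y) \<in> Cov \<and> (y, x) \<in> Cov" if x: "x \<in> A - D" and y: "y \<in> D - A" for x y
  proof -
    have V: "x \<in> V" "y \<in> V" using x y subs by auto
    \<comment> \<open>Each peeling removes exactly one of the two vertices, so their levels differ
      in both, and the pair is covered whichever colour it has.\<close>
    have "lev x < N" "lev y = N" "lev' y < N'" "lev' x = N'"
      using x y V peelingD(1)[OF pE, of y] peelingD(1)[OF pF, of x] by (auto simp: A_def D_def)
    then show ?thesis
      using EF[of x y] E_cov[of x y] F_cov[of x y] V x y by (auto simp: Cov_def)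
  qed
  \<comment> \<open>Five disjoint products: the pairs between \<open>A - D\<close> and
    \<open>D - A\<close> in both orders, and all pairs that meet \<open>I\<close>, including its
    diagonal.\<close>
  have "(A - D) \<times> (D - A) \<union> (D - A) \<times> (A - D) \<union> (I \<times> I \<union> I \<times> (V - I) \<union> (V - I) \<times> I) \<subseteq> Cov"
    using I_cov AD_cov subs by blast
  then have "card ((A - D) \<times> (D - A) \<union> (D - A) \<times> (A - D) \<union> (I \<times> I \<union> I \<times> (V - I) \<union> (V - I) \<times> I))
      \<le> card Cov"
    using finC by (intro card_mono) (auto simp: Cov_def)
  moreover have "card ((A - D) \<times> (D - A) \<union> (D - A) \<times> (A - D) \<union> (I \<times> I \<union> I \<times> (V - I) \<union> (V - I) \<times> I))
      = 2 * card (A - D) * card (D - A) + card I ^ 2 + 2 * card I * (card V - card I)"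
  proof -
    have "card ((A - D) \<times> (D - A) \<union> (D - A) \<times> (A - D) \<union> (I \<times> I \<union> I \<times> (V - I) \<union> (V - I) \<times> I))
      = card ((A - D) \<times> (D - A) \<union> (D - A) \<times> (A - D)) + card (I \<times> I \<union> I \<times> (V - I) \<union> (V - I) \<times> I)"
      using fins fin by (intro card_Un_disjoint) (auto simp: I_def)
    moreover have "card ((A - D) \<times> (D - A) \<union> (D - A) \<times> (A - D))
        = card ((A - D) \<times> (D - A)) + card ((D - A) \<times> (A - D))"
      using fins by (intro card_Un_disjoint) auto
    moreover have "card (I \<times> I \<union> I \<times> (V - I) \<union> (V - I) \<times> I)
        = card (I \<times> I \<union> I \<times> (V - I)) + card ((V - I) \<times> I)"
      using fins fin by (intro card_Un_disjoint) auto
    moreover have "card (I \<times> I \<union> I \<times> (V - I)) = card (I \<times> I) + card (I \<times> (V - I))"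
      using fins fin by (intro card_Un_disjoint) auto
    moreover have "card (V - I) = card V - card I"
      using fins subs by (simp add: card_Diff_subset)
    ultimately show ?thesis by (simp add: card_cartesian_product power2_eq_square algebra_simps)
  qed
  moreover have "card Cov \<le> 2 * card C + 2 * card C' + (2 * card B + card L)"
  proof -
    have "card Cov \<le> card C + card (C\<inverse>) + card C' + card (C'\<inverse>) + card B + card (B\<inverse>) + card L"
      unfolding Cov_def by (intro order_trans[OF card_Un_le] add_mono order_refl)
    then show ?thesis by simp
  qed
  ultimately show ?thesis
    using card_C card_C' card_BL unfolding I_def by (simp add: algebra_simps)
qed

section \<open>The quadratic inequality and its failure\<close>

text \<open>\<open>r\<close> is the permitted shortfall of \<open>n\<close> below
  \<open>5 * m + 2\<close>. Minimising over integers \<open>i\<close> leaves an inequality in the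
  excesses \<alpha> and \<delta> of \<open>a\<close> and \<open>d\<close> over
  \<open>2 * m + 1\<close>. The bound on \<open>r ^ 2\<close> makes its constant term positive, and
  \<open>2 * r \<le> m + 4\<close> takes care of the terms in the excesses.\<close>

lemma count_contradiction:
  fixes m n a d i r :: int
  assumes a: "2 * m < a" "a \<le> 3 * m" and d: "2 * m < d" "d \<le> 3 * m"
    and i: "0 \<le> i" and n: "5 * m + 2 - r \<le> n"
    and r: "1 \<le> r" "r ^ 2 \<le> 4 * m + 2" "2 * r \<le> m + 4"
    and count: "2 * (a - i) * (d - i) + i ^ 2 + 2 * i * (n - i) + i \<le> 2 * m * (a + d) + 2 * m * i"
  shows False
proof -
  define \<alpha> where "\<alpha> = a - 2 * m - 1"
  define \<delta> where "\<delta> = d - 2 * m - 1"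
  define \<rho> where "\<rho> = r + \<alpha> + \<delta>"
  have ad: "a = 2 * m + 1 + \<alpha>" "d = 2 * m + 1 + \<delta>" by (simp_all add: \<alpha>_def \<delta>_def)
  have nonneg: "0 \<le> \<alpha>" "\<alpha> \<le> m - 1" "0 \<le> \<delta>" "\<delta> \<le> m - 1" using a d by (auto simp: \<alpha>_def \<delta>_def)
  have "0 \<le> i * (n - (5 * m + 2 - r))" using i n by simp
  then have "2 * (2 * m + 1) + 2 * (m + 1) * (\<alpha> + \<delta>) + 2 * \<alpha> * \<delta> + i ^ 2 + i - 2 * i * \<rho> \<le> 0"
    using count unfolding ad \<rho>_def by (simp add: power2_eq_square algebra_simps)
  \<comment> \<open>A product of consecutive integers is never negative. This bounds the terms in
    \<open>i\<close> below by their exact integer minimum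
    \<open>\<rho> - \<rho> ^ 2\<close>.\<close>
  moreover have "0 \<le> (i - \<rho>) * (i - \<rho> + 1)"
    by (cases "i - \<rho> \<ge> 0") (auto intro: mult_nonneg_nonneg mult_nonpos_nonpos)
  ultimately have "2 * (2 * m + 1) + 2 * (m + 1) * (\<alpha> + \<delta>) + 2 * \<alpha> * \<delta> \<le> \<rho> ^ 2 - \<rho>"
    by (simp add: power2_eq_square algebra_simps)
  then have "4 * m + 2 - r ^ 2 + r + (2 * m + 3 - 2 * r) * (\<alpha> + \<delta>) \<le> \<alpha> ^ 2 + \<delta> ^ 2"
    unfolding \<rho>_def by (simp add: power2_eq_square algebra_simps)
  \<comment> \<open>Subtracting \<open>m - 1\<close> from the coefficient
    \<open>2 * m + 3 - 2 * r\<close> leaves \<open>m + 4 - 2 * r\<close>.\<close>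
  moreover have "\<alpha> ^ 2 \<le> (m - 1) * \<alpha>" "\<delta> ^ 2 \<le> (m - 1) * \<delta>"
    using nonneg by (auto simp: power2_eq_square intro: mult_right_mono)
  moreover have "0 \<le> (m + 4 - 2 * r) * (\<alpha> + \<delta>)" using nonneg r by simp
  ultimately show False using r by (simp add: algebra_simps)
qed

text \<open>If both relations were separated on every large set, then each would have a peeling, the
  other relation serving as its complement, and the sizes of the two removed sets would contradict
  the count.\<close>

lemma ex_not_separated:
  fixes V :: "'a set" and n m :: nat
  assumes fin: "finite V" and n: "card V = n"
    and E_sym: "\<And>x y. E x y \<Longrightarrow> E y x" and F_sym: "\<And>x y. F x y \<Longrightarrow> F y x"
    and EF: "\<And>x y. x \<in> V \<Longrightarrow> y \<in> V \<Longrightarrow> x \<noteq> y \<Longrightarrow> E x y \<or> F x y"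
    and r: "5 * int m + 2 - r \<le> int n" "1 \<le> r" "r ^ 2 \<le> 4 * int m + 2" "2 * r \<le> int m + 4"
  shows "\<exists>W\<subseteq>V. n \<le> card W + 2 * m \<and> (\<not> separated E m W \<or> \<not> separated F m W)"
proof (rule ccontr)
  assume "\<not> ?thesis"
  then have sep: "separated E m W" "separated F m W" if "W \<subseteq> V" "card V \<le> card W + 2 * m" for W
    using that n by blast+
  obtain N lev S where pE: "peeling V E m N lev S"
      "2 * m < card {x\<in>V. lev x < N}" "card {x\<in>V. lev x < N} \<le> 3 * m"
    using E_sym F_sym EF sep(1) sep(2) by (rule ex_peeling[OF fin, where F = F])
  have FE: "F x y \<or> E x y" if "x \<in> V" "y \<in> V" "x \<noteq> y" for x y using EF that by blast
  obtain N' lev' T where pF: "peeling V F m N' lev' T"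
      "2 * m < card {x\<in>V. lev' x < N'}" "card {x\<in>V. lev' x < N'} \<le> 3 * m"
    using F_sym E_sym FE sep(2) sep(1) by (rule ex_peeling[OF fin, where F = E])
  define A where "A = {x\<in>V. lev x < N}"
  define D where "D = {x\<in>V. lev' x < N'}"
  have fins: "finite A" "finite D" using fin by (auto simp: A_def D_def)
  have le: "card (A \<inter> D) \<le> card V" using fin by (intro card_mono) (auto simp: A_def)
  have A: "int (card (A - D)) = int (card A) - int (card (A \<inter> D))"
    using fins by (simp add: card_Diff_subset_Int card_mono of_nat_diff)
  have D: "int (card (D - A)) = int (card D) - int (card (A \<inter> D))"
    using fins by (simp add: card_Diff_subset_Int card_mono of_nat_diff Int_commute)
  have "int (2 * card (A - D) * card (D - A) + card (A \<inter> D) ^ 2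
           + 2 * card (A \<inter> D) * (card V - card (A \<inter> D)) + card (A \<inter> D))
         \<le> int (2 * m * (card A + card D) + 2 * m * card (A \<inter> D))"
    unfolding A_def D_def of_nat_le_iff
    using E_sym F_sym EF by (rule peelings_count[OF fin pE(1) pF(1)])
  then have "2 * (int (card A) - int (card (A \<inter> D))) * (int (card D) - int (card (A \<inter> D)))
      + int (card (A \<inter> D)) ^ 2 + 2 * int (card (A \<inter> D)) * (int n - int (card (A \<inter> D)))
      + int (card (A \<inter> D)) \<le> 2 * int m * (int (card A) + int (card D)) + 2 * int m * int (card (A \<inter> D))"
    using le n by (simp add: A D of_nat_diff)
  from count_contradiction[OF _ _ _ _ _ r this] show False
    using pE pF unfolding A_def D_def by linarith
qed

section \<open>From separations to digraphs and colours\<close>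

text \<open>\<open>P\<close> collects what is reachable, in the symmetric closure, from a vertex
  \<open>u\<close> that does not reach everything; no arc can leave such a set.\<close>

lemma not_connected_separated:
  assumes "wf_digraph H" "verts H \<noteq> {}" "\<not> Digraph_Component.connected H"
  obtains P Q where "verts H = P \<union> Q" "P \<inter> Q = {}" "P \<noteq> {}" "Q \<noteq> {}"
    "\<And>e. e \<in> arcs H \<Longrightarrow> \<not> (tail H e \<in> P \<and> head H e \<in> Q)"
proof -
  interpret H: wf_digraph H by fact
  interpret M: pair_wf_digraph "mk_symmetric H" by (rule H.wellformed_mk_symmetric)
  obtain u v where uv: "u \<in> verts H" "v \<in> verts H" "\<not> u \<rightarrow>\<^sup>*\<^bsub>mk_symmetric H\<^esub> v"
    using assms(2,3) by (auto simp: connected_def strongly_connected_def)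
  define P where "P = {x \<in> verts H. u \<rightarrow>\<^sup>*\<^bsub>mk_symmetric H\<^esub> x}"
  show thesis
  proof (rule that[of P "verts H - P"])
    show "P \<noteq> {}" using uv(1) M.reachable_refl[of u] by (auto simp: P_def)
    show "verts H - P \<noteq> {}" using uv by (auto simp: P_def)
    show "\<not> (tail H e \<in> P \<and> head H e \<in> verts H - P)" if "e \<in> arcs H" for e
    proof
      assume *: "tail H e \<in> P \<and> head H e \<in> verts H - P"
      have "tail H e \<rightarrow>\<^bsub>mk_symmetric H\<^esub> head H e"
        using that by (auto simp: parcs_mk_symmetric)
      then have "u \<rightarrow>\<^sup>*\<^bsub>mk_symmetric H\<^esub> head H e"
        using * by (auto simp: P_def intro: M.reachable_adj_trans)
      then show False using * by (auto simp: P_def)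
    qed
  qed (auto simp: P_def)
qed

definition colour_subgraph ::
  "('a, 'b) pre_digraph \<Rightarrow> ('a set \<Rightarrow> colour) \<Rightarrow> colour \<Rightarrow> 'a set \<Rightarrow> ('a, 'b) pre_digraph" where
  "colour_subgraph G c col W =
     \<lparr>verts = W, arcs = {e \<in> arcs G. tail G e \<in> W \<and> head G e \<in> W \<and> c {tail G e, head G e} = col},
      tail = tail G, head = head G\<rparr>"

lemma colour_subgraph_simps [simp]:
  "verts (colour_subgraph G c col W) = W"
  "arcs (colour_subgraph G c col W) =
     {e \<in> arcs G. tail G e \<in> W \<and> head G e \<in> W \<and> c {tail G e, head G e} = col}"
  "tail (colour_subgraph G c col W) = tail G"
  "head (colour_subgraph G c col W) = head G"
  by (simp_all add: colour_subgraph_def)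

lemma monochromatic_colour_subgraph: "monochromatic c (colour_subgraph G c col W)"
  by (auto simp: monochromatic_def)

text \<open>Symmetry is inherited because \<open>c\<close> colours unordered pairs: the reverse of
  an arc has the same colour.\<close>

lemma graph_colour_subgraph:
  assumes "graph G" "W \<subseteq> verts G"
  shows "graph (colour_subgraph G c col W)"
proof -
  interpret graph G by fact
  have "finite W" using assms(2) finite_verts finite_subset by blast
  moreover have "sym (arcs_ends (colour_subgraph G c col W))"
  proof (rule symI)
    fix x y assume "(x, y) \<in> arcs_ends (colour_subgraph G c col W)"
    then obtain e where e: "e \<in> arcs G" "x = tail G e" "y = head G e" "x \<in> W" "y \<in> W" "c {x, y} = col"
      by (auto simp: arcs_ends_conv)
    then have "(y, x) \<in> arcs_ends G"
      using sym_arcs by (auto simp: symmetric_def arcs_ends_conv dest: symD)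
    then show "(y, x) \<in> arcs_ends (colour_subgraph G c col W)"
      using e by (auto simp: arcs_ends_conv insert_commute)
  qed
  ultimately show ?thesis
    using no_loops no_multi_arcs
    by unfold_locales (auto simp: arc_to_ends_def symmetric_def)
qed

lemma subgraph_colour_subgraph:
  assumes "graph G" "W \<subseteq> verts G"
  shows "subgraph (colour_subgraph G c col W) G"
proof -
  interpret graph G by fact
  interpret H: graph "colour_subgraph G c col W" by (rule graph_colour_subgraph[OF assms])
  show ?thesis
    using assms(2) wf_digraph H.wf_digraph by (auto simp: subgraph_def compatible_def)
qed

text \<open>A small cut leaves two sides with no arc of colour \<open>col\<close> from one to the
  other. Since \<open>G\<close> is complete, every such pair is joined in \<open>G\<close>, so it
  must have the other colour, and the sides with the cut form a separation.\<close>

lemma k_connected_colour_subgraph: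
  assumes G: "complete_digraph n G" and W: "W \<subseteq> verts G" and large: "Suc m < card W"
    and nsep: "\<not> separated (\<lambda>x y. c {x, y} = col) m W"
  shows "k_connected (Suc m) (colour_subgraph G c col W)"
proof (rule ccontr)
  let ?H = "colour_subgraph G c col W"
  have gG: "graph G" using G by (simp add: complete_digraph_def)
  interpret H: graph ?H by (rule graph_colour_subgraph[OF gG W])
  assume "\<not> k_connected (Suc m) ?H"
  then obtain S where S: "S \<subset> W" "\<not> Digraph_Component.connected (?H \<restriction> (W - S))" "card S \<le> m"
    using large H.graph_axioms unfolding k_connected_def vertex_cut_def
    by (auto simp: less_Suc_eq_le)
  have "wf_digraph (?H \<restriction> (W - S))" by unfold_locales auto
  then obtain P Q where PQ: "W - S = P \<union> Q" "P \<inter> Q = {}" "P \<noteq> {}" "Q \<noteq> {}"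
      "\<And>e. e \<in> arcs (?H \<restriction> (W - S)) \<Longrightarrow> \<not> (tail G e \<in> P \<and> head G e \<in> Q)"
    using not_connected_separated[of "?H \<restriction> (W - S)"] S by auto
  have "c {x, y} \<noteq> col" if xy: "x \<in> P" "y \<in> Q" for x y
  proof
    assume col: "c {x, y} = col"
    have in_W: "x \<in> W - S" "y \<in> W - S" "x \<noteq> y" using xy PQ by auto
    then have "(x, y) \<in> arcs_ends G"
      using W G by (auto simp: complete_digraph_def)
    then obtain e where "e \<in> arcs G" "tail G e = x" "head G e = y"
      by (auto simp: arcs_ends_conv)
    then show False using PQ(5)[of e] in_W col xy by (auto simp: induce_subgraph_def)
  qed
  moreover have "W = P \<union> S \<union> Q" "P \<inter> S = {}" "S \<inter> Q = {}" using PQ(1) S(1) by auto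
  ultimately have "separated (\<lambda>x y. c {x, y} = col) m W"
    unfolding separated_def using PQ(2-4) S(3) by metis
  then show False using nsep by simp
qed

theorem theorem1:
  fixes k n :: nat and G :: "('a, 'b) pre_digraph" and c :: "'a set \<Rightarrow> colour"
  assumes "0 < k" and "0 < n"
    and "(k, n) \<noteq> (1, 1)"
    and "real n \<ge> 5 * real k - sqrt (4 * real k - 2) - 3"
    and "real n \<ge> 5 * real k - 0.5 * real k - 4"
    and "complete_digraph n G"
  shows "\<exists>H. subgraph H G \<and> monochromatic c H \<and> k_connected k H \<and>
           int (card (verts H)) \<ge> int n - 2 * int k + 2"
proof -
  obtain m where k: "k = Suc m" using assms(1) gr0_implies_Suc by blast
  have G: "graph G" "card (verts G) = n" using assms(6) by (auto simp: complete_digraph_def)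
  interpret graph G by fact
  \<comment> \<open>As \<open>5 * k - 3 = 5 * m + 2\<close> and
    \<open>4 * k - 2 = 4 * m + 2\<close>, the first bound on \<open>n\<close> says that the
    shortfall is at most the root of \<open>4 * m + 2\<close>. The maximum keeps \<open>r\<close>
    positive when \<open>n\<close> is large.\<close>
  define r where "r = max 1 (5 * int m + 2 - int n)"
  \<comment> \<open>The second bound on \<open>n\<close>, doubled. A shortfall
    \<open>r = 5 * m + 2 - n\<close> then satisfies \<open>2 * r \<le> m + 3\<close>.\<close>
  have half: "9 * int m + 1 \<le> 2 * int n"
  proof -
    have "9 * real m + 1 \<le> 2 * real n" using assms(5) by (simp add: k field_simps)
    then show ?thesis by linarith
  qed
  have "r ^ 2 \<le> 4 * int m + 2"
  proof (cases "5 * int m + 2 - int n \<le> 1")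
    case True
    then show ?thesis by (simp add: r_def)
  next
    case False
    then have r: "r = 5 * int m + 2 - int n" by (simp add: r_def)
    have "real_of_int r \<le> sqrt (4 * real m + 2)" using assms(4) by (simp add: r k algebra_simps)
    then have "real_of_int r ^ 2 \<le> sqrt (4 * real m + 2) ^ 2"
      by (intro power_mono) (auto simp: r_def)
    then have "real_of_int (r ^ 2) \<le> real_of_int (4 * int m + 2)" by simp
    then show ?thesis by linarith
  qed
  moreover have "2 * r \<le> int m + 4" "1 \<le> r" "5 * int m + 2 - r \<le> int n"
    using half by (auto simp: r_def max_def)
  moreover have "c {x, y} = Red \<or> c {x, y} = Blue" for x y
    by (cases "c {x, y}") auto
  \<comment> \<open>The size bound is the required one, since
    \<open>n - 2 * m = n - 2 * k + 2\<close>.\<close>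
  ultimately have "\<exists>W\<subseteq>verts G. n \<le> card W + 2 * m \<and>
      (\<not> separated (\<lambda>x y. c {x, y} = Red) m W \<or> \<not> separated (\<lambda>x y. c {x, y} = Blue) m W)"
    using G finite_verts by (intro ex_not_separated[of "verts G" n _ _ m r]) (auto simp: insert_commute)
  then obtain W col where W: "W \<subseteq> verts G" "n \<le> card W + 2 * m"
      and col: "\<not> separated (\<lambda>x y. c {x, y} = col) m W" by blast
  \<comment> \<open>For \<open>k = 1\<close> the set \<open>W\<close> has at least \<open>n\<close>
    vertices, and \<open>n \<ge> 2\<close> because \<open>(k, n)\<close> is not
    \<open>(1, 1)\<close>. For larger \<open>k\<close>, \<open>half\<close> gives
    \<open>n - 2 * m > m + 1\<close>.\<close>
  have "Suc m < card W"
  proof (cases m)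
    case 0
    then show ?thesis using W(2) assms(2,3) k by auto
  next
    case (Suc l)
    then show ?thesis using W(2) half by linarith
  qed
  then have "k_connected k (colour_subgraph G c col W)"
    using k_connected_colour_subgraph[OF assms(6) W(1) _ col] k by simp
  then show ?thesis
    using subgraph_colour_subgraph[OF G(1) W(1)] monochromatic_colour_subgraph W(2) k
    by (intro exI[of _ "colour_subgraph G c col W"]) auto
qed

end
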